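(* For any $\varepsilon>0$ and any $\boldsymbol\theta=(\theta_1,\dots,\theta_N)\in\mathbb{R}^{K\times N}$, define $\boldsymbol\vartheta:=\boldsymbol\theta/\varepsilon$ (i.e. $\vartheta_i=\theta_i/\varepsilon$ for all $i\in[N]$). Then, for all $x\in\Omega$, \[ F_{\boldsymbol\vartheta}(x)=F_{\boldsymbol\theta}(x),\qquad (p_{\boldsymbol\theta}^{\varepsilon})_i(x)=(p_{\boldsymbol\vartheta}^{1})_i(x)\quad\text{for all } i\in[N], \] and in particular $\Phi_\varepsilon^G(\boldsymbol\theta)=\Phi_1^G(\boldsymbol\vartheta)$.
   Context: Let $\overline\Omega=[-1,1]^2$ and let $\Omega\subset\overline\Omega$ be a nonempty finite set (of pixels). Let $N>1$ and $K\ge 1$ be integers and $[N]:=\{1,\dots,N\}$. Let $G:\Omega\to[N]$ be a given map (the grain map) and $\eta:\overline\Omega\to\mathbb{R}^K$ a given function (the design function). For $\boldsymbol\theta=(\theta_1,\dots,\theta_N)\in\mathbb{R}^{K\times N}$ with $\theta_i\in\mathbb{R}^K$, set $h_{\theta_i}(x):=\theta_i\cdot\eta(x)$ for $x\in\overline\Omega$. Hard assignment: $F_{\boldsymbol\theta}(x):=\operatorname{arg\,min}_{i\in[N]}h_{\theta_i}(x)$, where if the minimiser is not unique the smallest minimising index is selected. Soft assignment, for $\varepsilon>0$: \[ (p_{\boldsymbol\theta}^\varepsilon)_i(x):=\frac{\exp\left(-\frac1\varepsilon h_{\theta_i}(x)\right)}{\sum_{j=1}^N\exp\left(-\frac1\varepsilon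 h_{\theta_j}(x)\right)},\qquad i\in[N]. \] Objective function, for $\varepsilon>0$: \[ \Phi_\varepsilon^G(\boldsymbol\theta):=\frac{1}{|\Omega|}\sum_{x\in\Omega}\log\big((p_{\boldsymbol\theta}^\varepsilon)_{G(x)}(x)\big). \] *)

theory Defs
  imports "HOL-Analysis.Analysis"
begin

(* R^K is real ^ 'k, so K = CARD('k) >= 1.  A parameter tuple in R^{K x N} is a function
   nat => real ^ 'k, of which only the values at the indices 1, ..., N are ever used. *)

definition domain_closure :: "(real \<times> real) set" where
  "domain_closure = {-1..1} \<times> {-1..1}"

definition cell_fun :: "(real \<times> real \<Rightarrow> real ^ 'k) \<Rightarrow> real ^ 'k \<Rightarrow> real \<times> real \<Rightarrow> real" where
  "cell_fun \<eta> w x = w \<bullet> \<eta> x"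

definition hard_assignment ::
  "nat \<Rightarrow> (real \<times> real \<Rightarrow> real ^ 'k) \<Rightarrow> (nat \<Rightarrow> real ^ 'k) \<Rightarrow> real \<times> real \<Rightarrow> nat" where
  "hard_assignment N \<eta> \<theta> x =
     (LEAST i. is_arg_min (\<lambda>i. cell_fun \<eta> (\<theta> i) x) (\<lambda>i. i \<in> {1..N}) i)"

definition soft_assignment ::
  "nat \<Rightarrow> (real \<times> real \<Rightarrow> real ^ 'k) \<Rightarrow> real \<Rightarrow> (nat \<Rightarrow> real ^ 'k) \<Rightarrow> nat \<Rightarrow> real \<times> real \<Rightarrow> real" where
  "soft_assignment N \<eta> \<epsilon> \<theta> i x =
     exp (- (1 / \<epsilon>) * cell_fun \<eta> (\<theta> i) x) /
     (\<Sum>j = 1..N. exp (- (1 / \<epsilon>) * cell_fun \<eta> (\<theta> j) x))"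

definition objective ::
  "nat \<Rightarrow> (real \<times> real) set \<Rightarrow> (real \<times> real \<Rightarrow> nat) \<Rightarrow> (real \<times> real \<Rightarrow> real ^ 'k) \<Rightarrow>
   real \<Rightarrow> (nat \<Rightarrow> real ^ 'k) \<Rightarrow> real" where
  "objective N \<Omega> G \<eta> \<epsilon> \<theta> =
     (1 / real (card \<Omega>)) * (\<Sum>x\<in>\<Omega>. ln (soft_assignment N \<eta> \<epsilon> \<theta> (G x) x))"

end

theory Submission
  imports Defs
begin

text \<open>
  Since \<^term>\<open>cell_fun\<close> is linear in the parameter, dividing every parameter by
  \<open>\<epsilon>\<close> divides every value \<open>h\<^sub>i(x)\<close> by \<open>\<epsilon>\<close>.  As \<open>\<epsilon> > 0\<close>, this preserves the order of
  these values, hence the set of minimisers and the smallest one among them.  The exponents in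
  the soft assignment depend on \<open>h\<^sub>i(x) / \<epsilon>\<close> alone, so the factor can be moved from the
  temperature into the parameters; the objective is built from soft assignments at the indices
  \<open>G x\<close>, all of which lie between 1 and \<open>N\<close>.
\<close>

lemma cell_fun_scaleR: "cell_fun \<eta> (c *\<^sub>R w) x = c * cell_fun \<eta> w x"
  by (simp add: cell_fun_def)

lemma hard_assignment_scaleR:
  assumes "c > 0" and "\<And>i. i \<in> {1..N} \<Longrightarrow> \<theta>' i = c *\<^sub>R \<theta> i"
  shows "hard_assignment N \<eta> \<theta>' x = hard_assignment N \<eta> \<theta> x"
proof -
  have "cell_fun \<eta> (\<theta>' j) x < cell_fun \<eta> (\<theta>' i) x \<longleftrightarrow>
      cell_fun \<eta> (\<theta> j) x < cell_fun \<eta> (\<theta> i) x" if "i \<in> {1..N}" "j \<in> {1..N}" for i j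
    using assms(1) by (simp add: assms(2)[OF that(1)] assms(2)[OF that(2)] cell_fun_scaleR)
  then have "is_arg_min (\<lambda>i. cell_fun \<eta> (\<theta>' i) x) (\<lambda>i. i \<in> {1..N}) =
      is_arg_min (\<lambda>i. cell_fun \<eta> (\<theta> i) x) (\<lambda>i. i \<in> {1..N})"
    unfolding is_arg_min_def fun_eq_iff by blast
  then show ?thesis
    by (simp add: hard_assignment_def)
qed

lemma soft_assignment_rescale:
  assumes "\<And>i. i \<in> {1..N} \<Longrightarrow> \<theta>' i = \<theta> i /\<^sub>R \<epsilon>" and "i \<in> {1..N}"
  shows "soft_assignment N \<eta> \<epsilon> \<theta> i x = soft_assignment N \<eta> 1 \<theta>' i x"
proof -
  have weight: "exp (- (1 / \<epsilon>) * cell_fun \<eta> (\<theta> j) x) = exp (- (1 / 1) * cell_fun \<eta> (\<theta>' j) x)"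
    if "j \<in> {1..N}" for j
    by (simp add: assms(1)[OF that] cell_fun_scaleR divide_inverse)
  show ?thesis
    unfolding soft_assignment_def
    by (intro arg_cong2[where f = "(/)"] sum.cong refl weight assms(2))
qed

theorem lemma4p1:
  fixes N :: nat
    and \<Omega> :: "(real \<times> real) set"
    and G :: "real \<times> real \<Rightarrow> nat"
    and \<eta> :: "real \<times> real \<Rightarrow> real ^ 'k"
    and \<epsilon> :: real
    and \<theta> \<theta>' :: "nat \<Rightarrow> real ^ 'k"
  assumes "N > 1"
    and "finite \<Omega>" and "\<Omega> \<noteq> {}" and "\<Omega> \<subseteq> domain_closure"
    and "G \<in> \<Omega> \<rightarrow> {1..N}"
    and "\<epsilon> > 0"
    and "\<And>i. i \<in> {1..N} \<Longrightarrow> \<theta>' i = \<theta> i /\<^sub>R \<epsilon>"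
  shows "(\<forall>x\<in>\<Omega>. hard_assignment N \<eta> \<theta>' x = hard_assignment N \<eta> \<theta> x \<and>
            (\<forall>i\<in>{1..N}. soft_assignment N \<eta> \<epsilon> \<theta> i x = soft_assignment N \<eta> 1 \<theta>' i x)) \<and>
         objective N \<Omega> G \<eta> \<epsilon> \<theta> = objective N \<Omega> G \<eta> 1 \<theta>'"
proof (intro conjI ballI)
  fix x
  show "hard_assignment N \<eta> \<theta>' x = hard_assignment N \<eta> \<theta> x"
    using assms(6,7) by (intro hard_assignment_scaleR[where c = "inverse \<epsilon>"]) auto
next
  fix x i
  assume "i \<in> {1..N}"
  then show "soft_assignment N \<eta> \<epsilon> \<theta> i x = soft_assignment N \<eta> 1 \<theta>' i x"
    by (intro soft_assignment_rescale assms(7))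
next
  have "soft_assignment N \<eta> \<epsilon> \<theta> (G x) x = soft_assignment N \<eta> 1 \<theta>' (G x) x" if "x \<in> \<Omega>" for x
    using assms(5) that by (intro soft_assignment_rescale assms(7)) auto
  then show "objective N \<Omega> G \<eta> \<epsilon> \<theta> = objective N \<Omega> G \<eta> 1 \<theta>'"
    by (simp add: objective_def)
qed

end
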